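(* Let $(X,T,A)$ be a soft $T_{0U}$ topological space. Then $(X,T,A)$ is a soft $T_{(0,1)}$ space if and only if for each $x,y\in X$ with $x\not\approx y$, there are soft open sets $(G,A)$ and $(H,A)$ in $X$ such that $x\in(G,A)$, $y\in(H,A)$, $x\notin(H,A)$ and $y\notin(G,A)$.
   Context: A soft set over a set $X$ with parameter set $A$ is a pair $(F,A)$ with $F:A\to\mathcal P(X)$; $SS(X)_A$ is the set of all of them. $0_A$ and $1_A$ denote the soft sets with constant value $\emptyset$, respectively $X$. Soft union, soft intersection $\sqcap$, complement $(F,A)^c$ and inclusion $\sqsubseteq$ are defined parameterwise. For $x\in X$, $x\in(F,A)$ means $x\in F(a)$ for all $a\in A$; $x\notin(F,A)$ means $x\notin F(a)$ for some $a\in A$. A soft topology on $X$ is a family $T\subseteq SS(X)_A$ containing $0_A,1_A$ and closed under binary soft intersections and arbitrary soft unions; members of $T$ are soft open. A soft neighbourhood of $x$ is a soft set $(F,A)$ such that $x\in(G,A)\sqsubseteq(F,A)$ for some $(G,A)\in T$; $\mathcal U_x$ is the collection of these. Write $x\approx y$ if $x\in(G,A)$ for each $(G,A)\in\mathcal U_y$ and $y\in(F,A)$ for each $(F,A)\in\mathcal U_x$. The space is soft $T_{0U}$ if whenever $x\approx y$, for every $a\in A$ and $(F,A)\in T$: $x\in F(a)$ if and only if $y\in F(a)$. Soft $T_0$ reflection: $X_0$ is the set of equivalence classes of $\approx$ on $X$, $r_X:X\to X_0$ the canonical surjection, and $T_0$ is the soft topology on $X_0$ consisting of those $(F,A)\in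 SS(X_0)_A$ for which the soft set $a\mapsto r_X^{-1}(F(a))$ belongs to $T$; $(X_0,T_0,A)$ is the soft $T_0$ reflection of $(X,T,A)$. A soft topological space is soft $T_1$ if for all distinct points $x,y$ there are soft open sets $(G,A),(H,A)$ with $x\in(G,A)$, $y\notin(G,A)$, $y\in(H,A)$, $x\notin(H,A)$. $(X,T,A)$ is soft $T_{(0,1)}$ if $(X_0,T_0,A)$ is soft $T_1$. *)

theory Defs
  imports "HOL-Library.FuncSet"
begin

text \<open>
  A soft set over \<open>X\<close> with parameter set \<open>A\<close> is a function from \<open>A\<close> to the power set of \<open>X\<close>.
  It is represented as an element of \<open>A \<rightarrow>\<^sub>E Pow X\<close>, so that HOL equality of such functions is
  equality of soft sets. Neither \<open>X\<close> nor \<open>A\<close> is assumed to be nonempty.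
\<close>

definition soft_sets :: "'x set \<Rightarrow> 'a set \<Rightarrow> ('a \<Rightarrow> 'x set) set" where
  "soft_sets X A = (A \<rightarrow>\<^sub>E Pow X)"

definition soft_null :: "'a set \<Rightarrow> 'a \<Rightarrow> 'x set" where
  "soft_null A = (\<lambda>a\<in>A. {})"

definition soft_absolute :: "'x set \<Rightarrow> 'a set \<Rightarrow> 'a \<Rightarrow> 'x set" where
  "soft_absolute X A = (\<lambda>a\<in>A. X)"

definition soft_inter :: "'a set \<Rightarrow> ('a \<Rightarrow> 'x set) \<Rightarrow> ('a \<Rightarrow> 'x set) \<Rightarrow> 'a \<Rightarrow> 'x set" where
  "soft_inter A F G = (\<lambda>a\<in>A. F a \<inter> G a)"

definition soft_Union :: "'a set \<Rightarrow> ('a \<Rightarrow> 'x set) set \<Rightarrow> 'a \<Rightarrow> 'x set" where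
  "soft_Union A S = (\<lambda>a\<in>A. \<Union>F\<in>S. F a)"

definition soft_subset :: "'a set \<Rightarrow> ('a \<Rightarrow> 'x set) \<Rightarrow> ('a \<Rightarrow> 'x set) \<Rightarrow> bool" where
  "soft_subset A F G \<longleftrightarrow> (\<forall>a\<in>A. F a \<subseteq> G a)"

text \<open>Non-membership in a soft set is the negation of the following, i.e. \<open>x \<notin> F a\<close> for some \<open>a \<in> A\<close>.\<close>

definition soft_mem :: "'a set \<Rightarrow> 'x \<Rightarrow> ('a \<Rightarrow> 'x set) \<Rightarrow> bool" where
  "soft_mem A x F \<longleftrightarrow> (\<forall>a\<in>A. x \<in> F a)"

definition soft_topology :: "'x set \<Rightarrow> ('a \<Rightarrow> 'x set) set \<Rightarrow> 'a set \<Rightarrow> bool" where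
  "soft_topology X T A \<longleftrightarrow>
     T \<subseteq> soft_sets X A \<and> soft_null A \<in> T \<and> soft_absolute X A \<in> T \<and>
     (\<forall>F\<in>T. \<forall>G\<in>T. soft_inter A F G \<in> T) \<and>
     (\<forall>S. S \<subseteq> T \<longrightarrow> soft_Union A S \<in> T)"

definition soft_nbhds :: "'x set \<Rightarrow> ('a \<Rightarrow> 'x set) set \<Rightarrow> 'a set \<Rightarrow> 'x \<Rightarrow> ('a \<Rightarrow> 'x set) set" where
  "soft_nbhds X T A x = {F \<in> soft_sets X A. \<exists>G\<in>T. soft_mem A x G \<and> soft_subset A G F}"

definition soft_indist :: "'x set \<Rightarrow> ('a \<Rightarrow> 'x set) set \<Rightarrow> 'a set \<Rightarrow> 'x \<Rightarrow> 'x \<Rightarrow> bool" where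
  "soft_indist X T A x y \<longleftrightarrow>
     (\<forall>G\<in>soft_nbhds X T A y. soft_mem A x G) \<and> (\<forall>F\<in>soft_nbhds X T A x. soft_mem A y F)"

definition soft_T0U :: "'x set \<Rightarrow> ('a \<Rightarrow> 'x set) set \<Rightarrow> 'a set \<Rightarrow> bool" where
  "soft_T0U X T A \<longleftrightarrow>
     (\<forall>x\<in>X. \<forall>y\<in>X. soft_indist X T A x y \<longrightarrow> (\<forall>a\<in>A. \<forall>F\<in>T. x \<in> F a \<longleftrightarrow> y \<in> F a))"

definition soft_T1 :: "'x set \<Rightarrow> ('a \<Rightarrow> 'x set) set \<Rightarrow> 'a set \<Rightarrow> bool" where
  "soft_T1 X T A \<longleftrightarrow>
     (\<forall>x\<in>X. \<forall>y\<in>X. x \<noteq> y \<longrightarrow>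
        (\<exists>G\<in>T. \<exists>H\<in>T. soft_mem A x G \<and> \<not> soft_mem A y G \<and> soft_mem A y H \<and> \<not> soft_mem A x H))"

definition soft_indist_rel :: "'x set \<Rightarrow> ('a \<Rightarrow> 'x set) set \<Rightarrow> 'a set \<Rightarrow> ('x \<times> 'x) set" where
  "soft_indist_rel X T A = {(x, y). x \<in> X \<and> y \<in> X \<and> soft_indist X T A x y}"

definition T0_points :: "'x set \<Rightarrow> ('a \<Rightarrow> 'x set) set \<Rightarrow> 'a set \<Rightarrow> 'x set set" where
  "T0_points X T A = X // soft_indist_rel X T A"

definition T0_proj :: "'x set \<Rightarrow> ('a \<Rightarrow> 'x set) set \<Rightarrow> 'a set \<Rightarrow> 'x \<Rightarrow> 'x set" where
  "T0_proj X T A x = soft_indist_rel X T A `` {x}"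

definition T0_opens :: "'x set \<Rightarrow> ('a \<Rightarrow> 'x set) set \<Rightarrow> 'a set \<Rightarrow> ('a \<Rightarrow> 'x set set) set" where
  "T0_opens X T A =
     {F \<in> soft_sets (T0_points X T A) A. (\<lambda>a\<in>A. {x \<in> X. T0_proj X T A x \<in> F a}) \<in> T}"

definition soft_T01 :: "'x set \<Rightarrow> ('a \<Rightarrow> 'x set) set \<Rightarrow> 'a set \<Rightarrow> bool" where
  "soft_T01 X T A \<longleftrightarrow> soft_T1 (T0_points X T A) (T0_opens X T A) A"

end

theory Submission
  imports Defs
begin

text \<open>
  The canonical surjection \<open>r\<close> onto the reflection induces, for a soft $T_{0U}$ space, a bijection
  between the soft open sets of \<open>X\<close> and those of the reflection. Pulling back along \<open>r\<close> always
  gives a soft open set, by the definition of the quotient soft topology. Conversely, the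
  condition $T_{0U}$ says that every value \<open>G a\<close> of a soft open set is a union of classes of
  indistinguishable points; hence \<open>G\<close> is the pullback of its direct image, and this direct image
  is soft open (\<open>T0_image_open\<close>). Both operations preserve and reflect soft membership of a point
  and of its class (\<open>soft_mem_T0_preimage\<close>, \<open>soft_mem_T0_image\<close>). Since two classes are distinct
  exactly when their representatives are distinguishable (\<open>T0_proj_eq_iff\<close>), a pair of soft open
  sets separating two classes is the same thing as a pair separating their representatives.
\<close>

text \<open>
  Every soft neighbourhood of a point contains a soft open set containing the point, and such a
  soft open set is itself a neighbourhood, so soft open sets suffice to test indistinguishability.
  This form makes it evident that the relation is an equivalence.
\<close>

lemma soft_indist_iff_open:
  assumes "T \<subseteq> soft_sets X A"
  shows "soft_indist X T A x y \<longleftrightarrow> (\<forall>G\<in>T. soft_mem A x G \<longleftrightarrow> soft_mem A y G)"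
proof -
  have nbhds: "(\<forall>F\<in>soft_nbhds X T A u. soft_mem A v F) \<longleftrightarrow>
      (\<forall>G\<in>T. soft_mem A u G \<longrightarrow> soft_mem A v G)" for u v
  proof
    assume L: "\<forall>F\<in>soft_nbhds X T A u. soft_mem A v F"
    show "\<forall>G\<in>T. soft_mem A u G \<longrightarrow> soft_mem A v G"
    proof (intro ballI impI)
      fix G assume "G \<in> T" "soft_mem A u G"
      then have "G \<in> soft_nbhds X T A u"
        using assms by (auto simp: soft_nbhds_def soft_subset_def)
      then show "soft_mem A v G" using L by blast
    qed
  next
    assume "\<forall>G\<in>T. soft_mem A u G \<longrightarrow> soft_mem A v G"
    then show "\<forall>F\<in>soft_nbhds X T A u. soft_mem A v F"
      by (fastforce simp: soft_nbhds_def soft_subset_def soft_mem_def)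
  qed
  show ?thesis unfolding soft_indist_def nbhds by blast
qed

lemma equiv_soft_indist_rel:
  assumes "T \<subseteq> soft_sets X A"
  shows "equiv X (soft_indist_rel X T A)"
  using soft_indist_iff_open[OF assms]
  by (auto simp: equiv_def refl_on_def sym_def trans_def soft_indist_rel_def)

lemma T0_proj_eq_iff:
  assumes "T \<subseteq> soft_sets X A" and "x \<in> X" "y \<in> X"
  shows "T0_proj X T A x = T0_proj X T A y \<longleftrightarrow> soft_indist X T A x y"
  using eq_equiv_class_iff[OF equiv_soft_indist_rel[OF assms(1)] assms(2,3)] assms(2,3)
  by (simp add: T0_proj_def soft_indist_rel_def)

lemma T0_points_eq_image: "T0_points X T A = T0_proj X T A ` X"
  by (auto simp: T0_points_def T0_proj_def quotient_def)

definition T0_preimage ::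
    "'x set \<Rightarrow> ('a \<Rightarrow> 'x set) set \<Rightarrow> 'a set \<Rightarrow> ('a \<Rightarrow> 'x set set) \<Rightarrow> 'a \<Rightarrow> 'x set" where
  "T0_preimage X T A F = (\<lambda>a\<in>A. {x \<in> X. T0_proj X T A x \<in> F a})"

definition T0_image ::
    "'x set \<Rightarrow> ('a \<Rightarrow> 'x set) set \<Rightarrow> 'a set \<Rightarrow> ('a \<Rightarrow> 'x set) \<Rightarrow> 'a \<Rightarrow> 'x set set" where
  "T0_image X T A G = (\<lambda>a\<in>A. T0_proj X T A ` G a)"

lemma T0_preimage_open: "F \<in> T0_opens X T A \<Longrightarrow> T0_preimage X T A F \<in> T"
  by (simp add: T0_opens_def T0_preimage_def)

lemma soft_mem_T0_preimage:
  "x \<in> X \<Longrightarrow> soft_mem A x (T0_preimage X T A F) \<longleftrightarrow> soft_mem A (T0_proj X T A x) F"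
  by (simp add: soft_mem_def T0_preimage_def)

text \<open>
  Soft $T_{0U}$ is the statement that the values of soft open sets are saturated for the
  canonical surjection.
\<close>

lemma T0_proj_mem_image_iff:
  assumes T: "T \<subseteq> soft_sets X A" and T0U: "soft_T0U X T A"
    and "G \<in> T" "a \<in> A" "x \<in> X"
  shows "T0_proj X T A x \<in> T0_proj X T A ` G a \<longleftrightarrow> x \<in> G a"
proof
  assume "T0_proj X T A x \<in> T0_proj X T A ` G a"
  then obtain y where y: "y \<in> G a" "T0_proj X T A x = T0_proj X T A y" by blast
  have "y \<in> X" using T assms(3,4) y(1) by (auto simp: soft_sets_def PiE_iff)
  then have "soft_indist X T A x y" using T0_proj_eq_iff[OF T assms(5)] y(2) by blast
  then show "x \<in> G a" using T0U y(1) \<open>y \<in> X\<close> assms(3-5) unfolding soft_T0U_def by blast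
qed blast

lemma T0_preimage_image:
  assumes "T \<subseteq> soft_sets X A" and "soft_T0U X T A" and "G \<in> T"
  shows "T0_preimage X T A (T0_image X T A G) = G"
proof
  fix a
  have G: "G \<in> A \<rightarrow>\<^sub>E Pow X" using assms(1,3) by (auto simp: soft_sets_def)
  show "T0_preimage X T A (T0_image X T A G) a = G a"
  proof (cases "a \<in> A")
    case True
    then have "G a \<subseteq> X" using G by (auto simp: PiE_iff)
    then show ?thesis using True T0_proj_mem_image_iff[OF assms True]
      by (auto simp: T0_preimage_def T0_image_def)
  next
    case False
    then show ?thesis using PiE_arb[OF G False] by (simp add: T0_preimage_def)
  qed
qed

lemma T0_image_open:
  assumes "T \<subseteq> soft_sets X A" and "soft_T0U X T A" and "G \<in> T"
  shows "T0_image X T A G \<in> T0_opens X T A"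
proof -
  have "T0_image X T A G \<in> soft_sets (T0_points X T A) A"
    using assms(1,3) by (fastforce simp: soft_sets_def T0_image_def T0_points_eq_image PiE_iff)
  moreover have "(\<lambda>a\<in>A. {x \<in> X. T0_proj X T A x \<in> T0_image X T A G a}) \<in> T"
    using T0_preimage_image[OF assms] assms(3) by (simp add: T0_preimage_def)
  ultimately show ?thesis by (simp add: T0_opens_def)
qed

lemma soft_mem_T0_image:
  assumes "T \<subseteq> soft_sets X A" and "soft_T0U X T A" and "G \<in> T" and "x \<in> X"
  shows "soft_mem A (T0_proj X T A x) (T0_image X T A G) \<longleftrightarrow> soft_mem A x G"
  using soft_mem_T0_preimage[OF assms(4), of A T "T0_image X T A G"] T0_preimage_image[OF assms(1-3)]
  by simp

theorem proposition4p3: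
  fixes X :: "'x set" and T :: "('a \<Rightarrow> 'x set) set" and A :: "'a set"
  assumes "soft_topology X T A" and "soft_T0U X T A"
  shows "soft_T01 X T A \<longleftrightarrow>
    (\<forall>x\<in>X. \<forall>y\<in>X. \<not> soft_indist X T A x y \<longrightarrow>
       (\<exists>G\<in>T. \<exists>H\<in>T. soft_mem A x G \<and> soft_mem A y H \<and> \<not> soft_mem A x H \<and> \<not> soft_mem A y G))"
proof -
  let ?r = "T0_proj X T A"
  have T: "T \<subseteq> soft_sets X A" using assms(1) by (simp add: soft_topology_def)
  note mem_image = soft_mem_T0_image[OF T assms(2)]
  have separated_iff:
    "(\<exists>G\<in>T0_opens X T A. \<exists>H\<in>T0_opens X T A. soft_mem A (?r x) G \<and> \<not> soft_mem A (?r y) G \<and>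
        soft_mem A (?r y) H \<and> \<not> soft_mem A (?r x) H) \<longleftrightarrow>
     (\<exists>G\<in>T. \<exists>H\<in>T. soft_mem A x G \<and> soft_mem A y H \<and> \<not> soft_mem A x H \<and> \<not> soft_mem A y G)"
    (is "?L \<longleftrightarrow> ?R") if "x \<in> X" "y \<in> X" for x y
  proof
    assume ?L
    then show ?R
      using T0_preimage_open soft_mem_T0_preimage[OF \<open>x \<in> X\<close>] soft_mem_T0_preimage[OF \<open>y \<in> X\<close>]
      by metis
  next
    assume ?R
    then show ?L
      using T0_image_open[OF T assms(2)] mem_image[OF _ \<open>x \<in> X\<close>] mem_image[OF _ \<open>y \<in> X\<close>]
      by metis
  qed
  show ?thesis
    unfolding soft_T01_def soft_T1_def T0_points_eq_image ball_simps
    by (intro ball_cong refl) (simp only: separated_iff T0_proj_eq_iff[OF T])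
qed

end
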